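(* Let $K\ge 1$ and let $\mathbf{A}\in\mathbb{R}^{K\times K}$ be an arbitrary symmetric matrix (not assumed positive-semidefinite or nonsingular). Then, without any pivoting (permutation of rows and columns), $\mathbf{A}$ has a Cholesky factorization over the hemiplex numbers: there exists a lower-triangular $K\times K$ matrix $\mathbf{L}$ with pure-hemi entries such that $\mathbf{A}=\mathbf{L}\mathbf{L}^*$.
   Context: The hemiplex numbers $\mathbb{J}$ are the real vector space of formal expressions $z=a+m\mu+n\nu$ with $a,m,n\in\mathbb{R}$ (basis $1,\mu,\nu$), with the $\mathbb{R}$-bilinear commutative (non-associative) multiplication with unit $1$ determined by $\mu^2=0$, $\nu^2=0$, $\mu\nu=\nu\mu=-\tfrac12$. Reals are identified with the multiples of $1$. A hemiplex number is pure-hemi if $a=0$; the set of these is $\mathbb{J}_0$ (it contains $0$). The conjugate of $z=a+m\mu+n\nu$ is $\bar z=a-m\mu-n\nu$. For a matrix $\mathbf{L}$ over $\mathbb{J}$, $\mathbf{L}^*$ is the conjugate transpose, $(\mathbf{L}^* )_{ij}=\overline{L_{ji}}$, and $(\mathbf{L}\mathbf{L}^* )_{ik}=\sum_j L_{ij}\overline{L_{kj}}$. *)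

theory Defs
  imports Complex_Main "Jordan_Normal_Form.Matrix"
begin

text \<open>\<open>Hemiplex a m n\<close> stands for \<open>a + m \<mu> + n \<nu>\<close>.\<close>

datatype hemiplex = Hemiplex (real_part: real) (mu_part: real) (nu_part: real)

lemma hemiplex_eq_iff:
  "z = w \<longleftrightarrow> real_part z = real_part w \<and> mu_part z = mu_part w \<and> nu_part z = nu_part w"
  by (cases z; cases w) auto

instantiation hemiplex :: real_vector
begin

definition "0 = Hemiplex 0 0 0"

definition "z + w = Hemiplex (real_part z + real_part w) (mu_part z + mu_part w) (nu_part z + nu_part w)"

definition "- z = Hemiplex (- real_part z) (- mu_part z) (- nu_part z)"

definition "z - (w::hemiplex) = z + - w"

definition "c *\<^sub>R z = Hemiplex (c * real_part z) (c * mu_part z) (c * nu_part z)"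

instance
  by standard
    (auto simp: zero_hemiplex_def plus_hemiplex_def uminus_hemiplex_def minus_hemiplex_def
      scaleR_hemiplex_def hemiplex_eq_iff algebra_simps)

end

text \<open>The multiplication is not associative, so there is no \<open>ring\<close> or \<open>semiring\<close> instance:
  only the notation classes are instantiated.\<close>

instantiation hemiplex :: "{one, times}"
begin

definition "1 = Hemiplex 1 0 0"

definition "z * w = Hemiplex
  (real_part z * real_part w - (mu_part z * nu_part w + nu_part z * mu_part w) / 2)
  (real_part z * mu_part w + mu_part z * real_part w)
  (real_part z * nu_part w + nu_part z * real_part w)"

instance ..

end

definition hemi_mu :: hemiplex where "hemi_mu = Hemiplex 0 1 0"

definition hemi_nu :: hemiplex where "hemi_nu = Hemiplex 0 0 1"

definition hemi_of_real :: "real \<Rightarrow> hemiplex" where "hemi_of_real a = a *\<^sub>R 1"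

text \<open>The following facts determine the multiplication: it is the commutative
  \<open>\<real>\<close>-bilinear product with unit \<open>1\<close> and the given values on the basis \<open>1, \<mu>, \<nu>\<close>.\<close>

lemma hemiplex_expansion:
  "z = hemi_of_real (real_part z) + mu_part z *\<^sub>R hemi_mu + nu_part z *\<^sub>R hemi_nu"
  by (simp add: hemi_of_real_def hemi_mu_def hemi_nu_def one_hemiplex_def plus_hemiplex_def
      scaleR_hemiplex_def)

lemma hemiplex_mult_basis:
  "hemi_mu * hemi_mu = 0"
  "hemi_nu * hemi_nu = 0"
  "hemi_mu * hemi_nu = hemi_of_real (- 1 / 2)"
  "hemi_nu * hemi_mu = hemi_of_real (- 1 / 2)"
  by (simp_all add: hemi_of_real_def hemi_mu_def hemi_nu_def one_hemiplex_def zero_hemiplex_def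
      times_hemiplex_def scaleR_hemiplex_def)

lemma hemiplex_mult_one: "1 * z = z" "z * 1 = z" for z :: hemiplex
  by (simp_all add: one_hemiplex_def times_hemiplex_def hemiplex_eq_iff)

lemma hemiplex_mult_commute: "z * w = w * z" for z w :: hemiplex
  by (simp add: times_hemiplex_def algebra_simps)

lemma hemiplex_mult_bilinear:
  fixes z w u :: hemiplex
  shows "(z + w) * u = z * u + w * u"
    and "u * (z + w) = u * z + u * w"
    and "(c *\<^sub>R z) * u = c *\<^sub>R (z * u)"
    and "u * (c *\<^sub>R z) = c *\<^sub>R (u * z)"
  by (simp_all add: times_hemiplex_def plus_hemiplex_def scaleR_hemiplex_def field_simps)

definition pure_hemi :: "hemiplex set" where "pure_hemi = {z. real_part z = 0}"

definition hemi_cnj :: "hemiplex \<Rightarrow> hemiplex" where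
  "hemi_cnj z = Hemiplex (real_part z) (- mu_part z) (- nu_part z)"

text \<open>The library's product of matrices requires entries in a \<open>semiring_0\<close>, hence an associative
  multiplication, so the product of hemiplex matrices is defined here.\<close>

definition hemi_mat_mult :: "hemiplex mat \<Rightarrow> hemiplex mat \<Rightarrow> hemiplex mat" where
  "hemi_mat_mult A B =
     mat (dim_row A) (dim_col B) (\<lambda>(i, k). \<Sum>j<dim_col A. A $$ (i, j) * B $$ (j, k))"

definition hemi_adjoint :: "hemiplex mat \<Rightarrow> hemiplex mat" where
  "hemi_adjoint L = map_mat hemi_cnj (transpose_mat L)"

definition lower_triangular :: "'a::zero mat \<Rightarrow> bool" where
  "lower_triangular L \<longleftrightarrow> (\<forall>i<dim_row L. \<forall>j<dim_col L. i < j \<longrightarrow> L $$ (i, j) = 0)"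

end

(* For pure-hemi z = m \<mu> + n \<nu> and w = p \<mu> + q \<nu> one has z * cnj w = (m q + n p) / 2, a hyperbolic form
   with isotropic axes. Hence L can be written down without recursion: its \<mu>-part is the identity and its
   \<nu>-part is the lower triangle of A with the off-diagonal entries doubled. In entry (i, k) of L L* only
   the column min i k contributes. *)
theory Submission
  imports Defs
begin

text \<open>The diagonal is not doubled: in a diagonal entry times its own conjugate both cross
  terms give half of \<open>A $$ (i, i)\<close>, while off the diagonal only one cross term is
  nonzero.\<close>

definition hemi_cholesky :: "real mat \<Rightarrow> hemiplex mat" where
  "hemi_cholesky A = mat (dim_row A) (dim_row A) (\<lambda>(i, j).
     if i < j then 0 else if i = j then Hemiplex 0 1 (A $$ (i, i)) else Hemiplex 0 0 (2 * A $$ (i, j)))"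

lemma hemi_cholesky_mult_adjoint:
  assumes A: "A \<in> carrier_mat K K" and sym: "transpose_mat A = A"
  shows "hemi_mat_mult (hemi_cholesky A) (hemi_adjoint (hemi_cholesky A)) = map_mat hemi_of_real A"
proof -
  define L where "L = hemi_cholesky A"
  have L: "L $$ (i, j) = (if i < j then 0 else if i = j then Hemiplex 0 1 (A $$ (i, i))
      else Hemiplex 0 0 (2 * A $$ (i, j)))" if "i < K" "j < K" for i j
    using A that by (simp add: L_def hemi_cholesky_def)
  have dim: "dim_row L = K" "dim_col L = K"
    using A by (simp_all add: L_def hemi_cholesky_def)
  have sym': "A $$ (i, k) = A $$ (k, i)" if "i < K" "k < K" for i k
    using that A sym by (metis carrier_matD index_transpose_mat(1))
  \<comment> \<open>For \<open>j < min i k\<close> both factors are multiples of the isotropic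
    \<nu>; for \<open>j > min i k\<close> one factor is 0. At \<open>j = min i k\<close> the \<mu>
    of a diagonal entry meets the \<nu>-part of the other factor. If \<open>i < k\<close>, that part
    is \<open>2 * A $$ (k, i)\<close>, hence the use of symmetry.\<close>
  have summand: "L $$ (i, j) * hemi_cnj (L $$ (k, j)) =
      (if j = min i k then hemi_of_real (A $$ (i, k)) else 0)"
    if "i < K" "j < K" "k < K" for i j k
    using that sym'[of i k]
    by (auto simp: L min_def hemi_cnj_def hemi_of_real_def one_hemiplex_def zero_hemiplex_def
        times_hemiplex_def scaleR_hemiplex_def)
  have "hemi_mat_mult L (hemi_adjoint L) = map_mat hemi_of_real A"
  proof (rule eq_matI)
    fix i k assume "i < dim_row (map_mat hemi_of_real A)" "k < dim_col (map_mat hemi_of_real A)"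
    then have ik: "i < K" "k < K" using A by auto
    then have "hemi_mat_mult L (hemi_adjoint L) $$ (i, k) =
        (\<Sum>j<K. L $$ (i, j) * hemi_cnj (L $$ (k, j)))"
      by (simp add: hemi_mat_mult_def hemi_adjoint_def dim)
    also have "\<dots> = (\<Sum>j<K. if j = min i k then hemi_of_real (A $$ (i, k)) else 0)"
      using ik by (intro sum.cong) (auto simp: summand)
    \<comment> \<open>The sum collapses to one term because \<open>min i k < K\<close>.\<close>
    also have "\<dots> = map_mat hemi_of_real A $$ (i, k)"
      using ik A by (simp add: min_def)
    finally show "hemi_mat_mult L (hemi_adjoint L) $$ (i, k) = map_mat hemi_of_real A $$ (i, k)" .
  qed (use A in \<open>auto simp: hemi_mat_mult_def hemi_adjoint_def dim\<close>)
  then show ?thesis by (simp add: L_def)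
qed

theorem mainTheorem1:
  fixes K :: nat and A :: "real mat"
  assumes "K \<ge> 1"
    and "A \<in> carrier_mat K K"
    and "transpose_mat A = A"
  shows "\<exists>L :: hemiplex mat. L \<in> carrier_mat K K
    \<and> lower_triangular L
    \<and> (\<forall>i<K. \<forall>j<K. L $$ (i, j) \<in> pure_hemi)
    \<and> map_mat hemi_of_real A = hemi_mat_mult L (hemi_adjoint L)"
proof (intro exI conjI)
  show "map_mat hemi_of_real A =
      hemi_mat_mult (hemi_cholesky A) (hemi_adjoint (hemi_cholesky A))"
    using hemi_cholesky_mult_adjoint[OF assms(2,3)] by simp
qed (use assms(2) in \<open>auto simp: hemi_cholesky_def lower_triangular_def pure_hemi_def
      zero_hemiplex_def\<close>)

end
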